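(* For every $\epsilon\ge 0$ there exist an information structure $\theta$, deterministic policies $\{P_i\}_i$, a stimulus $\mathbf{x}$ of positive probability, and two agent orders $\mathbf{i}$ and $\mathbf{i}'$ such that the following holds. Run on $\mathbf{x}$, the protocols $\Pi=(\mathbf{i},\{P_i\}_i)$ and $\Pi'=(\mathbf{i}',\{P_i\}_i)$ (same policies, different orders) terminate with final histories $h$ and $h'$ respectively, both of which are stable perceptions, i.e. $(\theta,h)$ and $(\theta,h')$ are $\epsilon$-consensuses, and $$D_{TV}(\mathbf{q}_h,\mathbf{q}_{h'})\ge 0.5.$$
   Context: $X_1,\dots,X_n,W$ are random variables with finite realization spaces $\mathcal{S}_1,\dots,\mathcal{S}_n,\Omega$; the information structure $\theta$ is their joint distribution, and all probabilities are with respect to $\theta$. Write $\mathbf{X}=(X_1,\dots,X_n)$; a stimulus is a realization $\mathbf{x}=(x_1,\dots,x_n)$ of $\mathbf{X}$. Shared blackboard communication: there are $n$ agents; agent $i$ privately sees $x_i$ and has a deterministic policy $P_i$. An order $\mathbf{i}=i_1,i_2,\dots$ is a sequence of agents. The board starts empty ($h^0$). At round $t$, agent $i_t$ writes the message $P_{i_t}(x_{i_t},h^{t-1})$ on the board, so the board contents become $h^t=(P_{i_t}(x_{i_t},h^{t-1}),h^{t-1})$. At the end of each round, every policy $P_i$ takes $h^t$ and outputs ``stop'' or ``continue''; the protocol terminates when all agents output ``stop''. A communication protocol is $\Pi=(\mathbf{i},\{P_i\}_i)$; $\Pi(\mathbf{x})$ denotes the final board contents on stimulus $\mathbf{x}$.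 Given a protocol $\Pi$ and a history (board contents) $h$ it can produce, $R_h$ is the set of stimuli leading to $h$ under $\Pi$ (this is always a hyperrectangle $B_1\times\cdots\times B_n$ with $B_i\subset\mathcal{S}_i$). Conditioning on $h$ means conditioning on $\{\mathbf{X}\in R_h\}$, and $\mathbf{q}_h(\omega)=\Pr[W=\omega\mid h]$. $(\theta,h)$ achieves $\epsilon$-consensus if $\mathrm{I}(X_i;W\mid h)\le\epsilon$ for all $i$, where $\mathrm{I}(\cdot;\cdot\mid h)$ is mutual information under the conditional distribution given $h$. $D_{TV}(\mathbf{p},\mathbf{q})=\frac12\sum_{\omega}|\mathbf{p}(\omega)-\mathbf{q}(\omega)|$. *)

theory Defs
  imports "HOL-Probability.Probability"
begin

text \<open>
  The agents are \<open>0, \<dots>, n - 1\<close>. A stimulus is an element of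
  \<open>PiE {..<n} S\<close>, and the joint distribution of \<open>(X, W)\<close> is a pmf on pairs
  of a stimulus and a value of \<open>W\<close>.
\<close>

record ('x, 'w) info_structure =
  agents :: nat
  signals :: "nat \<Rightarrow> 'x set"
  outcomes :: "'w set"
  joint :: "((nat \<Rightarrow> 'x) \<times> 'w) pmf"

definition stimuli :: "('x, 'w) info_structure \<Rightarrow> (nat \<Rightarrow> 'x) set" where
  "stimuli \<theta> = PiE {..<agents \<theta>} (signals \<theta>)"

definition valid_info_structure :: "('x, 'w) info_structure \<Rightarrow> bool" where
  "valid_info_structure \<theta> \<longleftrightarrow>
     (\<forall>i<agents \<theta>. finite (signals \<theta> i)) \<and> finite (outcomes \<theta>) \<and>
     set_pmf (joint \<theta>) \<subseteq> stimuli \<theta> \<times> outcomes \<theta>"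

definition stimulus_prob :: "('x, 'w) info_structure \<Rightarrow> (nat \<Rightarrow> 'x) \<Rightarrow> real" where
  "stimulus_prob \<theta> x = pmf (map_pmf fst (joint \<theta>)) x"

text \<open>
  Board contents are lists of messages, the most recent message first. The message of an agent
  depends on its signal and the board; the stopping decision depends on the board only.
\<close>

record ('x, 'm) policy =
  message :: "'x \<Rightarrow> 'm list \<Rightarrow> 'm"
  stops :: "'m list \<Rightarrow> bool"

text \<open>In the order \<open>ord\<close>, the agent writing in round \<open>t + 1\<close> is \<open>ord t\<close>.\<close>

type_synonym ('x, 'm) protocol = "(nat \<Rightarrow> nat) \<times> (nat \<Rightarrow> ('x, 'm) policy)"

definition agent_order :: "('x, 'w) info_structure \<Rightarrow> (nat \<Rightarrow> nat) \<Rightarrow> bool" where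
  "agent_order \<theta> ord \<longleftrightarrow> (\<forall>t. ord t < agents \<theta>)"

fun board :: "('x, 'm) protocol \<Rightarrow> (nat \<Rightarrow> 'x) \<Rightarrow> nat \<Rightarrow> 'm list" where
  "board (ord, P) x 0 = []"
| "board (ord, P) x (Suc t) =
     message (P (ord t)) (x (ord t)) (board (ord, P) x t) # board (ord, P) x t"

definition all_stop :: "('x, 'w) info_structure \<Rightarrow> ('x, 'm) protocol \<Rightarrow> 'm list \<Rightarrow> bool" where
  "all_stop \<theta> \<pi> h \<longleftrightarrow> (\<forall>i<agents \<theta>. stops (snd \<pi> i) h)"

text \<open>
  \<open>board \<pi> x t\<close> is defined for all \<open>t\<close>; the run on \<open>x\<close> actually reaches round \<open>t\<close> if it was not
  terminated at the end of an earlier round. There is no stopping decision before the first round.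
\<close>

definition reaches_round ::
  "('x, 'w) info_structure \<Rightarrow> ('x, 'm) protocol \<Rightarrow> (nat \<Rightarrow> 'x) \<Rightarrow> nat \<Rightarrow> bool" where
  "reaches_round \<theta> \<pi> x t \<longleftrightarrow> (\<forall>s\<in>{1..<t}. \<not> all_stop \<theta> \<pi> (board \<pi> x s))"

definition leads_to ::
  "('x, 'w) info_structure \<Rightarrow> ('x, 'm) protocol \<Rightarrow> (nat \<Rightarrow> 'x) \<Rightarrow> 'm list \<Rightarrow> bool" where
  "leads_to \<theta> \<pi> x h \<longleftrightarrow> (\<exists>t. reaches_round \<theta> \<pi> x t \<and> board \<pi> x t = h)"

definition terminates_with ::
  "('x, 'w) info_structure \<Rightarrow> ('x, 'm) protocol \<Rightarrow> (nat \<Rightarrow> 'x) \<Rightarrow> 'm list \<Rightarrow> bool" where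
  "terminates_with \<theta> \<pi> x h \<longleftrightarrow>
     (\<exists>t\<ge>1. reaches_round \<theta> \<pi> x t \<and> board \<pi> x t = h \<and> all_stop \<theta> \<pi> h)"

definition stimuli_leading_to :: "('x, 'w) info_structure \<Rightarrow> ('x, 'm) protocol \<Rightarrow> 'm list \<Rightarrow> (nat \<Rightarrow> 'x) set" where
  "stimuli_leading_to \<theta> \<pi> h = {x \<in> stimuli \<theta>. leads_to \<theta> \<pi> x h}"

text \<open>Meaningful only if \<open>stimuli_leading_to \<theta> \<pi> h\<close> has positive probability, as required by \<open>cond_pmf\<close>.\<close>

definition cond_joint ::
  "('x, 'w) info_structure \<Rightarrow> ('x, 'm) protocol \<Rightarrow> 'm list \<Rightarrow> ((nat \<Rightarrow> 'x) \<times> 'w) pmf" where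
  "cond_joint \<theta> \<pi> h = cond_pmf (joint \<theta>) {(x, w). x \<in> stimuli_leading_to \<theta> \<pi> h}"

definition posterior :: "('x, 'w) info_structure \<Rightarrow> ('x, 'm) protocol \<Rightarrow> 'm list \<Rightarrow> 'w \<Rightarrow> real" where
  "posterior \<theta> \<pi> h \<omega> = measure_pmf.prob (cond_joint \<theta> \<pi> h) {(x, w). w = \<omega>}"

text \<open>
  Mutual information in bits. The sort constraint makes the product of the two discrete
  sigma-algebras discrete.
\<close>

definition cond_mutual_info ::
  "('x::countable, 'w::countable) info_structure \<Rightarrow> ('x, 'm) protocol \<Rightarrow> 'm list \<Rightarrow> nat \<Rightarrow> real" where
  "cond_mutual_info \<theta> \<pi> h i =
     prob_space.mutual_information (measure_pmf (cond_joint \<theta> \<pi> h)) 2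
       (count_space UNIV) (count_space UNIV) (\<lambda>(x, w). x i) (\<lambda>(x, w). w)"

definition consensus ::
  "real \<Rightarrow> ('x::countable, 'w::countable) info_structure \<Rightarrow> ('x, 'm) protocol \<Rightarrow> 'm list \<Rightarrow> bool" where
  "consensus \<epsilon> \<theta> \<pi> h \<longleftrightarrow> (\<forall>i<agents \<theta>. cond_mutual_info \<theta> \<pi> h i \<le> \<epsilon>)"

definition D_TV :: "'w set \<Rightarrow> ('w \<Rightarrow> real) \<Rightarrow> ('w \<Rightarrow> real) \<Rightarrow> real" where
  "D_TV \<Omega> p p' = 1 / 2 * (\<Sum>\<omega>\<in>\<Omega>. \<bar>p \<omega> - p' \<omega>\<bar>)"

end

theory Submission
  imports Defs
begin

text \<open>
  Two agents see independent fair bits and \<open>W\<close> is their exclusive or. If agent 1 opens, it writes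
  the uninformative message 2 and everybody stops: each single bit is independent of \<open>W\<close>, so this
  is a 0-consensus on the uniform belief. If agent 0 opens, it reveals its bit, agent 1 then does
  the same, and the belief on \<open>W\<close> is a point mass. These beliefs are at distance exactly 1/2.
\<close>

text \<open>The signals are restricted to \<open>{..<2}\<close> because stimuli are elements of a
  \<open>PiE\<close>, hence \<open>undefined\<close> outside the agents.\<close>

definition xor_bits :: "nat \<times> nat \<Rightarrow> (nat \<Rightarrow> nat) \<times> nat" where
  "xor_bits = (\<lambda>(a, b). (\<lambda>i\<in>{..<2}. if i = 0 then a else b, if a = b then 0 else 1))"

definition xor_structure :: "(nat, nat) info_structure" where
  "xor_structure =
     \<lparr>agents = 2, signals = (\<lambda>_. {0, 1}), outcomes = {0, 1},
      joint = map_pmf xor_bits (pmf_of_set ({0, 1} \<times> {0, 1}))\<rparr>"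

text \<open>The message 2 is not a possible signal, so on stimuli of \<open>xor_structure\<close> a
  head equal to 2 marks exactly an opening by agent 1. The stopping rule is first consulted after
  round 1, so \<open>hd []\<close> never matters.\<close>

definition opener_policy :: "nat \<Rightarrow> (nat, nat) policy" where
  "opener_policy i =
     \<lparr>message = (\<lambda>x h. if i = 1 \<and> h = [] then 2 else x),
      stops = (\<lambda>h. hd h = 2 \<or> length h \<ge> 2)\<rparr>"

definition zero_stimulus :: "nat \<Rightarrow> nat" where
  "zero_stimulus = (\<lambda>i\<in>{..<2}. 0)"

text \<open>Serves to recognise the product of marginals in the definition of mutual information.
  Both types being countable, the product sigma-algebra is discrete and it suffices to compare the
  measures on singletons.\<close>

lemma measure_pmf_pair:
  fixes p :: "'a::countable pmf" and q :: "'b::countable pmf"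
  shows "distr p (count_space UNIV) id \<Otimes>\<^sub>M distr q (count_space UNIV) id =
         distr (pair_pmf p q) (count_space UNIV \<Otimes>\<^sub>M count_space UNIV) id"
    (is "?L = ?R")
proof -
  interpret q: prob_space "distr q (count_space UNIV) id"
    by (rule measure_pmf.prob_space_distr) simp
  have sets_UNIV: "sets (count_space UNIV \<Otimes>\<^sub>M count_space UNIV :: ('a \<times> 'b) measure) = UNIV"
    by (subst pair_measure_countable) auto
  show ?thesis
  proof (rule measure_eqI_countable[where A = UNIV])
    have "sets ?L = sets (count_space UNIV \<Otimes>\<^sub>M count_space UNIV :: ('a \<times> 'b) measure)"
      by (intro sets_pair_measure_cong) simp_all
    then show "sets ?L = Pow UNIV"
      by (simp add: sets_UNIV)
    show "sets ?R = Pow UNIV"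
      by (simp add: sets_UNIV)
    fix z :: "'a \<times> 'b"
    obtain a b where z: "z = (a, b)"
      by (cases z)
    have "emeasure ?L ({a} \<times> {b}) = ennreal (pmf p a) * ennreal (pmf q b)"
      by (subst q.emeasure_pair_measure_Times) (simp_all add: emeasure_distr emeasure_pmf_single)
    also have "\<dots> = emeasure ?R {(a, b)}"
      by (subst emeasure_distr)
         (simp_all add: sets_UNIV space_pair_measure emeasure_pmf_single pmf_pair ennreal_mult')
    finally show "emeasure ?L {z} = emeasure ?R {z}"
      by (simp add: z)
  qed simp_all
qed

text \<open>Mutual information is the KL divergence between the product of the marginals and the
  joint law. If the joint law is a product, its factors are forced to be the marginals, and the
  divergence is that of a measure from itself.\<close>

lemma mutual_information_eq_0_if_pair_pmf:
  fixes X :: "'a \<Rightarrow> 'b::countable" and Y :: "'a \<Rightarrow> 'c::countable"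
  assumes pair: "map_pmf (\<lambda>z. (X z, Y z)) p = pair_pmf q r"
  shows "prob_space.mutual_information (measure_pmf p) b (count_space UNIV) (count_space UNIV) X Y = 0"
proof -
  have q: "q = map_pmf X p"
    using map_fst_pair_pmf[of q r] by (simp add: pair[symmetric] pmf.map_comp o_def)
  have r: "r = map_pmf Y p"
    using map_snd_pair_pmf[of q r] by (simp add: pair[symmetric] pmf.map_comp o_def)
  let ?P = "distr p (count_space UNIV) X \<Otimes>\<^sub>M distr p (count_space UNIV) Y"
  let ?Q = "distr p (count_space UNIV \<Otimes>\<^sub>M count_space UNIV) (\<lambda>z. (X z, Y z))"
  interpret Q: prob_space ?Q
    by (rule measure_pmf.prob_space_distr) (simp add: space_pair_measure)
  have "?P = distr q (count_space UNIV) id \<Otimes>\<^sub>M distr r (count_space UNIV) id"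
    unfolding q r map_pmf_rep_eq by (simp add: distr_distr)
  also have "\<dots> = distr (map_pmf (\<lambda>z. (X z, Y z)) p) (count_space UNIV \<Otimes>\<^sub>M count_space UNIV) id"
    unfolding pair by (rule measure_pmf_pair)
  also have "\<dots> = ?Q"
    unfolding map_pmf_rep_eq by (subst distr_distr) (simp_all add: o_def space_pair_measure)
  finally have "?P = ?Q" .
  then show ?thesis
    using Q.KL_same_eq_0[of b]
    by (simp only: prob_space.mutual_information_def[OF measure_pmf.prob_space_axioms])
qed

text \<open>Independence gives information exactly 0, which settles all \<epsilon> at once and
  replaces entropy computations by equations between pmfs.\<close>

lemma consensus_if_pair_pmf:
  assumes "\<epsilon> \<ge> 0"
    and "\<And>i. i < agents \<theta> \<Longrightarrow>
      \<exists>q r. map_pmf (\<lambda>(x, w). (x i, w)) (cond_joint \<theta> \<pi> h) = pair_pmf q r"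
  shows "consensus \<epsilon> \<theta> \<pi> h"
  unfolding consensus_def
proof (intro allI impI)
  fix i assume "i < agents \<theta>"
  then obtain q r where "map_pmf (\<lambda>(x, w). (x i, w)) (cond_joint \<theta> \<pi> h) = pair_pmf q r"
    using assms(2) by blast
  then have "cond_mutual_info \<theta> \<pi> h i = 0"
    unfolding cond_mutual_info_def
    by (intro mutual_information_eq_0_if_pair_pmf[of _ _ _ q r]) (simp add: case_prod_unfold)
  with \<open>\<epsilon> \<ge> 0\<close> show "cond_mutual_info \<theta> \<pi> h i \<le> \<epsilon>"
    by simp
qed

lemma set_pmf_xor_structure:
  "set_pmf (joint xor_structure) = xor_bits ` ({0, 1} \<times> {0, 1})"
  by (simp add: xor_structure_def)

lemma valid_xor_structure: "valid_info_structure xor_structure"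
  unfolding valid_info_structure_def set_pmf_xor_structure
  by (auto simp: xor_structure_def stimuli_def xor_bits_def)

lemma xor_bits_eq_zero_stimulus_iff: "fst (xor_bits (a, b)) = zero_stimulus \<longleftrightarrow> a = 0 \<and> b = 0"
proof
  assume *: "fst (xor_bits (a, b)) = zero_stimulus"
  from fun_cong[OF *, of 0] fun_cong[OF *, of 1] show "a = 0 \<and> b = 0"
    by (simp add: xor_bits_def zero_stimulus_def)
qed (auto simp: xor_bits_def zero_stimulus_def)

lemma xor_bits_0_0: "xor_bits (0, 0) = (zero_stimulus, 0)"
  by (auto simp: xor_bits_def zero_stimulus_def)

lemma zero_stimulus_in_stimuli: "zero_stimulus \<in> stimuli xor_structure"
  by (auto simp: zero_stimulus_def stimuli_def xor_structure_def)

lemma stimulus_prob_zero_stimulus: "stimulus_prob xor_structure zero_stimulus > 0"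
proof -
  have "(zero_stimulus, 0) \<in> set_pmf (joint xor_structure)"
    unfolding set_pmf_xor_structure by (simp flip: xor_bits_0_0)
  then have "zero_stimulus \<in> set_pmf (map_pmf fst (joint xor_structure))"
    by force
  then show ?thesis
    unfolding stimulus_prob_def by (rule pmf_positive)
qed

text \<open>The opening message of agent 1 ignores its signal, hence the arbitrary
  \<open>x\<close>.\<close>

lemma terminates_1_opens: "terminates_with xor_structure (\<lambda>_. 1, opener_policy) x [2]"
  unfolding terminates_with_def
  by (rule exI[of _ 1]) (auto simp: reaches_round_def all_stop_def opener_policy_def)

text \<open>Every stimulus produces this history, so the conditioning event has probability
  1.\<close>

lemma cond_joint_1_opens:
  "cond_joint xor_structure (\<lambda>_. 1, opener_policy) [2] = joint xor_structure"
proof -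
  let ?A = "{(x, w :: nat). x \<in> stimuli_leading_to xor_structure (\<lambda>_. 1, opener_policy) [2]}"
  have "stimuli_leading_to xor_structure (\<lambda>_. 1, opener_policy) [2] = stimuli xor_structure"
    using terminates_1_opens
    by (auto simp: stimuli_leading_to_def leads_to_def terminates_with_def)
  then have sub: "set_pmf (joint xor_structure) \<subseteq> ?A"
    using valid_xor_structure by (auto simp: valid_info_structure_def)
  then have ne: "set_pmf (joint xor_structure) \<inter> ?A \<noteq> {}"
    by (metis inf.absorb1 set_pmf_not_empty)
  have "measure_pmf.prob (joint xor_structure) ?A = 1"
    using sub by (subst measure_pmf.prob_eq_1) (auto simp: AE_measure_pmf_iff)
  then show ?thesis
    unfolding cond_joint_def
    \<comment> \<open>Inside \<open>?A\<close> the normalising factor is 1; outside it both sides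
      vanish, since the support lies in \<open>?A\<close>.\<close>
    by (intro pmf_eqI, subst pmf_cond[OF ne]) (use sub in \<open>auto simp: pmf_eq_0_set_pmf\<close>)
qed

text \<open>One bit together with the exclusive or determines the other bit, so the map permutes the
  square \<open>{0, 1} \<times> {0, 1}\<close> and preserves its uniform law, which is a
  product.\<close>

lemma xor_signal_outcome_pair:
  assumes "i < 2"
  shows "map_pmf (\<lambda>(x, w). (x i, w)) (joint xor_structure) =
         pair_pmf (pmf_of_set {0, 1}) (pmf_of_set {0, 1})"
proof -
  let ?f = "\<lambda>z. case xor_bits z of (x, w) \<Rightarrow> (x i, w)"
  have "?f ` ({0, 1} \<times> {0, 1}) = {0, 1} \<times> {0, 1}"
    using assms by (auto simp: xor_bits_def image_iff less_2_cases_iff)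
  moreover have "inj_on ?f ({0, 1} \<times> {0, 1})"
    using assms by (auto simp: inj_on_def xor_bits_def)
  ultimately have "map_pmf ?f (pmf_of_set ({0, 1} \<times> {0, 1})) = pmf_of_set ({0, 1} \<times> {0, 1})"
    by (simp add: map_pmf_of_set_inj)
  also have "\<dots> = pair_pmf (pmf_of_set {0, 1}) (pmf_of_set {0, 1})"
    by (rule pmf_eqI) (auto simp: pmf_pair indicator_def)
  finally show ?thesis
    by (simp add: xor_structure_def pmf.map_comp o_def)
qed

lemma posterior_eq_pmf: "posterior \<theta> \<pi> h \<omega> = pmf (map_pmf snd (cond_joint \<theta> \<pi> h)) \<omega>"
  unfolding posterior_def pmf_map
  by (rule arg_cong[where f = "measure_pmf.prob _"]) auto

lemma posterior_1_opens:
  assumes "w \<in> {0, 1}"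
  shows "posterior xor_structure (\<lambda>_. 1, opener_policy) [2] w = 1 / 2"
proof -
  have "map_pmf snd (joint xor_structure) = map_pmf snd (map_pmf (\<lambda>(x, w). (x 0, w)) (joint xor_structure))"
    by (simp add: pmf.map_comp o_def case_prod_unfold)
  also have "\<dots> = pmf_of_set {0, 1}"
    by (subst xor_signal_outcome_pair) (simp_all add: map_snd_pair_pmf)
  finally show ?thesis
    unfolding posterior_eq_pmf cond_joint_1_opens using assms by auto
qed

text \<open>Index 0 is the first round. The run ends after two rounds; the constant tail completes
  the infinite sequence.\<close>

abbreviation zero_then_one :: "nat \<Rightarrow> nat" where
  "zero_then_one t \<equiv> (if t = 0 then 0 else 1)"

lemma terminates_0_opens:
  "terminates_with xor_structure (zero_then_one, opener_policy) zero_stimulus [0, 0]"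
  unfolding terminates_with_def
proof (intro exI[of _ 2] conjI)
  show "reaches_round xor_structure (zero_then_one, opener_policy) zero_stimulus 2"
  proof -
    \<comment> \<open>The only earlier stopping decision is on the board \<open>[0]\<close>, which
      is too short and does not start with 2.\<close>
    have "{1..<2::nat} = {1}"
      by auto
    then show ?thesis
      by (auto simp: reaches_round_def all_stop_def opener_policy_def zero_stimulus_def
          xor_structure_def intro: exI[of _ 0])
  qed
qed (simp_all add: numeral_2_eq_2 all_stop_def opener_policy_def zero_stimulus_def)

text \<open>Lets a history determine the round in which it was on the board.\<close>

lemma length_board: "length (board \<pi> x t) = t"
  by (cases \<pi>) (induction t, simp_all)

text \<open>Once agent 0 has opened, both messages are the raw bits, so the board determines the
  stimulus.\<close>

lemma leads_to_0_opens_iff: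
  assumes "x \<in> stimuli xor_structure"
  shows "leads_to xor_structure (zero_then_one, opener_policy) x [0, 0] \<longleftrightarrow> x = zero_stimulus"
proof
  assume "leads_to xor_structure (zero_then_one, opener_policy) x [0, 0]"
  then obtain t where t: "board (zero_then_one, opener_policy) x t = [0, 0]"
    by (auto simp: leads_to_def)
  then have "t = 2"
    using length_board[of "(zero_then_one, opener_policy)" x t] by simp
  with t have "x 0 = 0" "x 1 = 0"
    by (simp_all add: numeral_2_eq_2 opener_policy_def)
  then show "x = zero_stimulus"
    using assms
    by (intro PiE_ext[of x "{..<2}" "\<lambda>_. {0, 1}"])
       (auto simp: stimuli_def xor_structure_def zero_stimulus_def less_2_cases_iff)
next
  assume "x = zero_stimulus"
  then show "leads_to xor_structure (zero_then_one, opener_policy) x [0, 0]"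
    using terminates_0_opens by (auto simp: leads_to_def terminates_with_def)
qed

lemma cond_joint_0_opens:
  "cond_joint xor_structure (zero_then_one, opener_policy) [0, 0] = return_pmf (zero_stimulus, 0)"
proof -
  have lead: "stimuli_leading_to xor_structure (zero_then_one, opener_policy) [0, 0] = {zero_stimulus}"
    using zero_stimulus_in_stimuli by (auto simp: stimuli_leading_to_def leads_to_0_opens_iff)
  \<comment> \<open>Only the bits (0, 0) give \<open>zero_stimulus\<close>, and then the outcome is
    0.\<close>
  have inter: "set_pmf (joint xor_structure) \<inter> {(x, w). x = zero_stimulus} = {(zero_stimulus, 0)}"
    unfolding set_pmf_xor_structure
    using xor_bits_eq_zero_stimulus_iff
    by (auto simp: image_iff xor_bits_0_0) (metis fst_conv xor_bits_0_0 snd_conv)+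
  then have "set_pmf (cond_pmf (joint xor_structure) {(x, w). x = zero_stimulus}) = {(zero_stimulus, 0)}"
    by (subst set_cond_pmf) auto
  then show ?thesis
    by (simp add: cond_joint_def lead flip: set_pmf_subset_singleton)
qed

theorem mainTheorem3:
  fixes \<epsilon> :: real
  assumes "\<epsilon> \<ge> 0"
  shows "\<exists>(\<theta> :: (nat, nat) info_structure) (P :: nat \<Rightarrow> (nat, nat) policy) x ord ord'.
           valid_info_structure \<theta> \<and>
           x \<in> stimuli \<theta> \<and> stimulus_prob \<theta> x > 0 \<and>
           agent_order \<theta> ord \<and> agent_order \<theta> ord' \<and>
           (\<exists>h h'.
              terminates_with \<theta> (ord, P) x h \<and>
              terminates_with \<theta> (ord', P) x h' \<and>
              consensus \<epsilon> \<theta> (ord, P) h \<and>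
              consensus \<epsilon> \<theta> (ord', P) h' \<and>
              D_TV (outcomes \<theta>) (posterior \<theta> (ord, P) h) (posterior \<theta> (ord', P) h') \<ge> 0.5)"
proof -
  let ?\<pi> = "(\<lambda>_. 1, opener_policy)" and ?\<pi>' = "(zero_then_one, opener_policy)"
  have "agent_order xor_structure (\<lambda>_. 1)" "agent_order xor_structure zero_then_one"
    by (simp_all add: agent_order_def xor_structure_def)
  moreover have "consensus \<epsilon> xor_structure ?\<pi> [2]"
    using assms
  proof (rule consensus_if_pair_pmf)
    fix i assume "i < agents xor_structure"
    then have "i < 2"
      by (simp add: xor_structure_def)
    then show "\<exists>q r. map_pmf (\<lambda>(x, w). (x i, w)) (cond_joint xor_structure ?\<pi> [2]) = pair_pmf q r"
      unfolding cond_joint_1_opens using xor_signal_outcome_pair by blast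
  qed
  moreover have "consensus \<epsilon> xor_structure ?\<pi>' [0, 0]"
    using assms
  proof (rule consensus_if_pair_pmf)
    fix i
    \<comment> \<open>Nothing is left to learn: a point mass on a pair is a product of point
      masses.\<close>
    have "map_pmf (\<lambda>(x, w). (x i, w)) (cond_joint xor_structure ?\<pi>' [0, 0]) =
        pair_pmf (return_pmf (zero_stimulus i)) (return_pmf 0)"
      unfolding cond_joint_0_opens by simp
    then show "\<exists>q r. map_pmf (\<lambda>(x, w). (x i, w)) (cond_joint xor_structure ?\<pi>' [0, 0]) = pair_pmf q r"
      by blast
  qed
  moreover have "D_TV (outcomes xor_structure) (posterior xor_structure ?\<pi> [2])
      (posterior xor_structure ?\<pi>' [0, 0]) \<ge> 0.5"
  proof -
    have "posterior xor_structure ?\<pi>' [0, 0] w = (if w = 0 then 1 else 0)" for w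
      by (simp add: posterior_eq_pmf cond_joint_0_opens)
    moreover have "outcomes xor_structure = {0, 1}"
      by (simp add: xor_structure_def)
    \<comment> \<open>Each of the two outcomes contributes a difference of 1/2, so the bound is
      attained.\<close>
    ultimately show ?thesis
      using posterior_1_opens[of 0] posterior_1_opens[of 1] by (simp add: D_TV_def)
  qed
  ultimately show ?thesis
    using valid_xor_structure zero_stimulus_in_stimuli stimulus_prob_zero_stimulus
      terminates_1_opens[of zero_stimulus] terminates_0_opens
    by blast
qed

end
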